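(* Every semiprime skew brace embeds as a skew brace in a direct product of prime skew braces; that is, for every semiprime skew brace $A$ there are a family $(Q_i)_{i\in T}$ of prime skew braces and an injective skew brace homomorphism $A\to\prod_{i\in T}Q_i$.
   Context: A skew brace is a triple $(A,+,\circ)$ where $(A,+)$ and $(A,\circ)$ are (not necessarily abelian) groups with $a\circ(b+c)=a\circ b-a+a\circ c$ for all $a,b,c\in A$ (the two groups share the identity element $0$). A skew brace homomorphism is a map preserving both operations; direct products carry componentwise operations. For $a,b\in A$ put $\lambda_a(b)=-a+a\circ b$ and $a*b=\lambda_a(b)-b$. For subsets $X,Y\subseteq A$, $X*Y$ denotes the subgroup of $(A,+)$ generated by $\{x*y:x\in X,\ y\in Y\}$. An ideal of $A$ is a normal subgroup $I$ of $(A,\circ)$ such that $\lambda_a(I)\subseteq I$ and $a+I=I+a$ for all $a\in A$. $A$ is prime if $I*J\neq 0$ for all non-zero ideals $I,J$ of $A$. $A$ is semiprime if $I*I\neq 0$ for every non-zero ideal $I$ of $A$. *)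

theory Defs
  imports "HOL-Algebra.AbelCoset" "HOL-Algebra.Product_Groups"
begin

text \<open>
  A skew brace is carried by a \<open>ring\<close> record: \<open>\<oplus>\<close>, \<open>\<zero>\<close> is the additive group (written
  additively but not assumed abelian) and \<open>\<otimes>\<close>, \<open>\<one>\<close> is the circle group.
  That \<open>\<one> = \<zero>\<close> follows from the axioms, see \<open>skew_brace.one_eq_zero\<close> below.
\<close>

locale skew_brace =
  fixes A (structure)
  assumes add_group: "group (add_monoid A)"
    and circ_group: "group A"
    and brace: "\<lbrakk>a \<in> carrier A; b \<in> carrier A; c \<in> carrier A\<rbrakk>
      \<Longrightarrow> a \<otimes> (b \<oplus> c) = a \<otimes> b \<ominus> a \<oplus> a \<otimes> c"

definition sb_lambda :: "('a, 'm) ring_scheme \<Rightarrow> 'a \<Rightarrow> 'a \<Rightarrow> 'a"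
  where "sb_lambda A a b = \<ominus>\<^bsub>A\<^esub> a \<oplus>\<^bsub>A\<^esub> a \<otimes>\<^bsub>A\<^esub> b"

definition sb_star :: "('a, 'm) ring_scheme \<Rightarrow> 'a \<Rightarrow> 'a \<Rightarrow> 'a"
  where "sb_star A a b = sb_lambda A a b \<ominus>\<^bsub>A\<^esub> b"

definition sb_star_set :: "('a, 'm) ring_scheme \<Rightarrow> 'a set \<Rightarrow> 'a set \<Rightarrow> 'a set"
  where "sb_star_set A X Y = generate (add_monoid A) {sb_star A x y | x y. x \<in> X \<and> y \<in> Y}"

definition sb_ideal :: "('a, 'm) ring_scheme \<Rightarrow> 'a set \<Rightarrow> bool"
  where "sb_ideal A I \<longleftrightarrow> I \<lhd> A
    \<and> (\<forall>a\<in>carrier A. sb_lambda A a ` I \<subseteq> I)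
    \<and> (\<forall>a\<in>carrier A. a <+\<^bsub>A\<^esub> I = I +>\<^bsub>A\<^esub> a)"

definition prime_skew_brace :: "('a, 'm) ring_scheme \<Rightarrow> bool"
  where "prime_skew_brace A \<longleftrightarrow> skew_brace A
    \<and> (\<forall>I J. sb_ideal A I \<and> I \<noteq> {\<zero>\<^bsub>A\<^esub>} \<and> sb_ideal A J \<and> J \<noteq> {\<zero>\<^bsub>A\<^esub>}
         \<longrightarrow> sb_star_set A I J \<noteq> {\<zero>\<^bsub>A\<^esub>})"

definition semiprime_skew_brace :: "('a, 'm) ring_scheme \<Rightarrow> bool"
  where "semiprime_skew_brace A \<longleftrightarrow> skew_brace A
    \<and> (\<forall>I. sb_ideal A I \<and> I \<noteq> {\<zero>\<^bsub>A\<^esub>} \<longrightarrow> sb_star_set A I I \<noteq> {\<zero>\<^bsub>A\<^esub>})"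

definition skew_brace_hom ::
    "('a, 'm) ring_scheme \<Rightarrow> ('b, 'n) ring_scheme \<Rightarrow> ('a \<Rightarrow> 'b) set"
  where "skew_brace_hom A B = hom (add_monoid A) (add_monoid B) \<inter> hom A B"

definition skew_brace_product ::
    "'i set \<Rightarrow> ('i \<Rightarrow> ('b, 'm) ring_scheme) \<Rightarrow> ('i \<Rightarrow> 'b) ring"
  where "skew_brace_product T Q =
    \<lparr>carrier = (\<Pi>\<^sub>E i\<in>T. carrier (Q i)),
     mult = (\<lambda>x y. \<lambda>i\<in>T. x i \<otimes>\<^bsub>Q i\<^esub> y i),
     one = (\<lambda>i\<in>T. \<one>\<^bsub>Q i\<^esub>),
     zero = (\<lambda>i\<in>T. \<zero>\<^bsub>Q i\<^esub>),
     add = (\<lambda>x y. \<lambda>i\<in>T. x i \<oplus>\<^bsub>Q i\<^esub> y i)\<rparr>"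

lemma (in skew_brace) one_eq_zero: "\<one> = \<zero>"
proof -
  interpret add: group "add_monoid A" by (rule add_group)
  interpret circ: group A by (rule circ_group)
  have z: "\<zero> \<in> carrier A" using add.one_closed by simp
  have o: "\<one> \<in> carrier A" by simp
  have "\<zero> = \<one> \<otimes> (\<zero> \<oplus> \<zero>)"
    using z add.l_one[of \<zero>] by simp
  also have "\<dots> = \<one> \<otimes> \<zero> \<ominus> \<one> \<oplus> \<one> \<otimes> \<zero>"
    using brace[OF o z z] .
  also have "\<dots> = \<ominus> \<one>"
    using z o add.l_one[of "\<ominus> \<one>"] add.r_one[of "\<ominus> \<one>"] add.inv_closed[of \<one>]
    by (simp add: a_minus_def a_inv_def)
  finally have "\<ominus> \<one> = \<zero>" by simp
  then show ?thesis
    using add.inv_inv[of \<one>] add.inv_one o by (simp add: a_inv_def)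
qed

lemma skew_brace_product:
  assumes Q: "\<And>i. i \<in> T \<Longrightarrow> skew_brace (Q i)"
  shows "skew_brace (skew_brace_product T Q)"
proof -
  let ?P = "skew_brace_product T Q"
  have car: "carrier ?P = (\<Pi>\<^sub>E i\<in>T. carrier (Q i))"
    by (simp add: skew_brace_product_def)
  have add: "add_monoid ?P = product_group T (\<lambda>i. add_monoid (Q i))"
    by (simp add: skew_brace_product_def product_group_def)
  have gQ: "group (add_monoid (Q i))" "group (Q i)" if "i \<in> T" for i
    using Q[OF that] by (simp_all add: skew_brace_def)
  have gadd: "group (add_monoid ?P)"
    unfolding add by (rule product_group) (rule gQ)
  have "group (product_group T Q)"
    by (rule product_group) (rule gQ)
  then have gcirc: "group ?P"
    unfolding group_def monoid_def group_axioms_def Units_def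
      skew_brace_product_def product_group_def partial_object.simps monoid.simps .
  have ainv: "\<ominus>\<^bsub>?P\<^esub> x = (\<lambda>i\<in>T. \<ominus>\<^bsub>Q i\<^esub> x i)" if "x \<in> carrier ?P" for x
    unfolding a_inv_def add by (rule inv_product_group) (use that gQ car in simp_all)
  show ?thesis
  proof (rule skew_brace.intro[OF gadd gcirc])
    fix a b c assume abc: "a \<in> carrier ?P" "b \<in> carrier ?P" "c \<in> carrier ?P"
    have br: "a i \<otimes>\<^bsub>Q i\<^esub> (b i \<oplus>\<^bsub>Q i\<^esub> c i)
        = a i \<otimes>\<^bsub>Q i\<^esub> b i \<ominus>\<^bsub>Q i\<^esub> a i \<oplus>\<^bsub>Q i\<^esub> a i \<otimes>\<^bsub>Q i\<^esub> c i" if "i \<in> T" for i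
      using skew_brace.brace[OF Q[OF that]] abc that unfolding car by (meson PiE_mem)
    show "a \<otimes>\<^bsub>?P\<^esub> (b \<oplus>\<^bsub>?P\<^esub> c) = a \<otimes>\<^bsub>?P\<^esub> b \<ominus>\<^bsub>?P\<^esub> a \<oplus>\<^bsub>?P\<^esub> a \<otimes>\<^bsub>?P\<^esub> c"
      unfolding a_minus_def ainv[OF abc(1)]
      by (rule ext) (simp add: skew_brace_product_def restrict_def br a_minus_def)
  qed
qed

end

theory Submission imports Defs begin

text \<open>
  It suffices to separate each \<open>a \<noteq> 0\<close> from \<open>0\<close> by a prime quotient. As in the theorem for
  semiprime rings, semiprimeness yields a sequence of non-zero elements \<open>s\<^sub>0 = a\<close>,
  \<open>s\<^sub>n\<^sub>+\<^sub>1 = x * y\<close> with \<open>x\<close>, \<open>y\<close> in the ideal \<open>\<langle>s\<^sub>n\<rangle>\<close>, and these ideals decrease. Let \<open>P\<close> be an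
  ideal maximal among those containing no \<open>s\<^sub>n\<close>. Ideals strictly above \<open>P\<close> both
  contain \<open>\<langle>s\<^sub>n\<rangle>\<close> for large \<open>n\<close>, hence some star product of their elements is
  \<open>s\<^sub>n\<^sub>+\<^sub>1 \<notin> P\<close>, so \<open>A / P\<close> is prime.
\<close>

section \<open>The two group structures and the lambda maps\<close>

context skew_brace
begin

sublocale circ: group A
  by (rule circ_group)

text \<open>The rewrites restate the facts of the additive group through \<open>\<oplus>\<close>,
  \<open>\<zero>\<close> and \<open>\<ominus>\<close>, so that the simplifier meets a single
  notation.\<close>

sublocale add: group "add_monoid A"
  rewrites "carrier (add_monoid A) = carrier A"
    and "monoid.mult (add_monoid A) = add A"
    and "monoid.one (add_monoid A) = zero A"
    and "m_inv (add_monoid A) = a_inv A"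
  by (rule add_group) (simp_all add: a_inv_def)

lemma lambda_closed [simp]:
  "\<lbrakk>a \<in> carrier A; b \<in> carrier A\<rbrakk> \<Longrightarrow> sb_lambda A a b \<in> carrier A"
  by (simp add: sb_lambda_def)

lemma circ_eq_add_lambda:
  assumes "a \<in> carrier A" "b \<in> carrier A"
  shows "a \<otimes> b = a \<oplus> sb_lambda A a b"
  using assms by (simp add: sb_lambda_def add.m_assoc[symmetric])

text \<open>This is the brace law with \<open>\<ominus> a\<close> added on the left.\<close>

lemma lambda_add:
  assumes "a \<in> carrier A" "b \<in> carrier A" "c \<in> carrier A"
  shows "sb_lambda A a (b \<oplus> c) = sb_lambda A a b \<oplus> sb_lambda A a c"
  using assms by (simp add: sb_lambda_def brace a_minus_def add.m_assoc)

lemma lambda_circ: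
  assumes "a \<in> carrier A" "b \<in> carrier A" "c \<in> carrier A"
  shows "sb_lambda A (a \<otimes> b) c = sb_lambda A a (sb_lambda A b c)"
proof -
  \<comment> \<open>Both sides are \<open>a \<otimes> b \<otimes> c\<close>, bracketed differently.
    The claim follows by expanding the right side with additivity of lambda and cancelling
    \<open>a \<otimes> b\<close> additively.\<close>
  have "(a \<otimes> b) \<oplus> sb_lambda A (a \<otimes> b) c = a \<otimes> (b \<oplus> sb_lambda A b c)"
    using assms by (simp add: circ_eq_add_lambda[symmetric] circ.m_assoc)
  also have "\<dots> = a \<oplus> sb_lambda A a (b \<oplus> sb_lambda A b c)"
    using assms by (simp add: circ_eq_add_lambda)
  also have "\<dots> = (a \<otimes> b) \<oplus> sb_lambda A a (sb_lambda A b c)"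
    using assms by (simp add: lambda_add circ_eq_add_lambda[of a b] add.m_assoc)
  finally show ?thesis using assms by simp
qed

lemma lambda_zero: "b \<in> carrier A \<Longrightarrow> sb_lambda A \<zero> b = b"
  using circ.l_one[of b] add.inv_one by (simp add: sb_lambda_def one_eq_zero)

lemma lambda_inv_cancel:
  assumes "a \<in> carrier A" "b \<in> carrier A"
  shows "sb_lambda A a (sb_lambda A (inv a) b) = b"
  using assms lambda_circ[of a "inv a" b] by (simp add: lambda_zero one_eq_zero)

lemma lambda_self_inv: "a \<in> carrier A \<Longrightarrow> sb_lambda A a (inv a) = \<ominus> a"
  by (simp add: sb_lambda_def one_eq_zero)

text \<open>Converse of \<open>circ_eq_add_lambda\<close>: since \<open>sb_lambda A (inv a)\<close>
  inverts \<open>sb_lambda A a\<close>, sums can be rewritten as circle products. This transports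
  closure properties from the circle group to the additive group.\<close>

lemma add_eq_circ_lambda:
  assumes "a \<in> carrier A" "b \<in> carrier A"
  shows "a \<oplus> b = a \<otimes> sb_lambda A (inv a) b"
  using assms by (simp add: circ_eq_add_lambda lambda_inv_cancel)

section \<open>Ideals: characterisations, intersections, unions of chains, cosets\<close>

lemma sb_ideal_add_normal:
  assumes "sb_ideal A I"
  shows "I \<lhd> add_monoid A"
proof -
  have nI: "I \<lhd> A" and lam: "\<And>a x. \<lbrakk>a \<in> carrier A; x \<in> I\<rbrakk> \<Longrightarrow> sb_lambda A a x \<in> I"
    and cos: "\<And>a. a \<in> carrier A \<Longrightarrow> a <+ I = I +> a"
    using assms by (auto simp: sb_ideal_def)
  interpret I: normal I A by (rule nI)
  have "subgroup I (add_monoid A)"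
  proof (rule subgroup.intro)
    show "I \<subseteq> carrier (add_monoid A)" using I.subset by simp
    show "x \<otimes>\<^bsub>add_monoid A\<^esub> y \<in> I" if "x \<in> I" "y \<in> I" for x y
      using that by (simp add: add_eq_circ_lambda lam)
    show "\<one>\<^bsub>add_monoid A\<^esub> \<in> I" using I.one_closed by (simp add: one_eq_zero)
    \<comment> \<open>The additive inverse of \<open>x\<close> is the lambda image, under
      \<open>x\<close>, of its circle inverse, which already lies in \<open>I\<close>.\<close>
    show "inv\<^bsub>add_monoid A\<^esub> x \<in> I" if "x \<in> I" for x
      using that lam[of x "inv x"] by (simp add: lambda_self_inv a_inv_def)
  qed
  then show ?thesis
    using cos add_group by (intro normal.intro normal_axioms.intro)
      (simp_all add: a_l_coset_def a_r_coset_def)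
qed

lemma sb_ideal_iff_normal:
  "sb_ideal A I \<longleftrightarrow> I \<lhd> A \<and> I \<lhd> add_monoid A
    \<and> (\<forall>a\<in>carrier A. \<forall>x\<in>I. sb_lambda A a x \<in> I)"
proof
  assume "sb_ideal A I"
  then show "I \<lhd> A \<and> I \<lhd> add_monoid A \<and> (\<forall>a\<in>carrier A. \<forall>x\<in>I. sb_lambda A a x \<in> I)"
    using sb_ideal_add_normal by (auto simp: sb_ideal_def)
next
  assume "I \<lhd> A \<and> I \<lhd> add_monoid A \<and> (\<forall>a\<in>carrier A. \<forall>x\<in>I. sb_lambda A a x \<in> I)"
  then show "sb_ideal A I"
    using normal.coset_eq[of I "add_monoid A"]
    by (auto simp: sb_ideal_def a_l_coset_def a_r_coset_def)
qed

text \<open>The elementwise closure conditions make stability under intersections, unions of chains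
  and preimages a matter of checking each clause.\<close>

lemma sb_ideal_iff:
  "sb_ideal A I \<longleftrightarrow> I \<subseteq> carrier A \<and> \<zero> \<in> I
    \<and> (\<forall>x\<in>I. \<forall>y\<in>I. x \<otimes> y \<in> I) \<and> (\<forall>x\<in>I. inv x \<in> I)
    \<and> (\<forall>x\<in>I. \<forall>y\<in>I. x \<oplus> y \<in> I) \<and> (\<forall>x\<in>I. \<ominus> x \<in> I)
    \<and> (\<forall>a\<in>carrier A. \<forall>x\<in>I. a \<otimes> x \<otimes> inv a \<in> I)
    \<and> (\<forall>a\<in>carrier A. \<forall>x\<in>I. a \<oplus> x \<oplus> \<ominus> a \<in> I)
    \<and> (\<forall>a\<in>carrier A. \<forall>x\<in>I. sb_lambda A a x \<in> I)"
  unfolding sb_ideal_iff_normal circ.normal_inv_iff add.normal_inv_iff subgroup_def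
  by (auto simp: one_eq_zero a_inv_def[symmetric])

lemma sb_ideal_subset: "sb_ideal A I \<Longrightarrow> I \<subseteq> carrier A"
  and sb_ideal_zero: "sb_ideal A I \<Longrightarrow> \<zero> \<in> I"
  by (simp_all add: sb_ideal_iff)

lemma sb_ideal_star:
  assumes "sb_ideal A I" "x \<in> I" "y \<in> I"
  shows "sb_star A x y \<in> I"
  using assms by (simp add: sb_ideal_iff sb_star_def a_minus_def subset_iff)

lemma sb_ideal_zero_set: "sb_ideal A {\<zero>}"
proof -
  have r_zero: "a \<otimes> \<zero> = a" if "a \<in> carrier A" for a
    using that circ.r_one[of a] by (simp add: one_eq_zero)
  have "inv \<zero> = \<zero>" "\<ominus> \<zero> = \<zero>"
    using circ.inv_one add.inv_one by (simp_all add: one_eq_zero)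
  then show ?thesis
    by (simp add: sb_ideal_iff sb_lambda_def one_eq_zero r_zero)
qed

lemma sb_ideal_carrier: "sb_ideal A (carrier A)"
  by (simp add: sb_ideal_iff)

lemma sb_ideal_Inter:
  assumes "\<I> \<noteq> {}" "\<And>I. I \<in> \<I> \<Longrightarrow> sb_ideal A I"
  shows "sb_ideal A (\<Inter>\<I>)"
proof -
  \<comment> \<open>One member is needed to bound the intersection by the carrier, since the empty
    intersection is the whole type.\<close>
  obtain J where "J \<in> \<I>" using assms(1) by blast
  then have "\<Inter>\<I> \<subseteq> carrier A" using assms(2) sb_ideal_subset by blast
  then show ?thesis
    using assms(2) by (simp add: sb_ideal_iff)
qed

lemma sb_ideal_Union_chain:
  assumes "\<C> \<noteq> {}" "\<And>I. I \<in> \<C> \<Longrightarrow> sb_ideal A I"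
    and "\<And>I J. \<lbrakk>I \<in> \<C>; J \<in> \<C>\<rbrakk> \<Longrightarrow> I \<subseteq> J \<or> J \<subseteq> I"
  shows "sb_ideal A (\<Union>\<C>)"
proof -
  \<comment> \<open>Comparability of the members enters only here, for the two binary operations;
    the other closure conditions involve one element of the union and hence one member.\<close>
  have common: "\<exists>I\<in>\<C>. x \<in> I \<and> y \<in> I" if "x \<in> \<Union>\<C>" "y \<in> \<Union>\<C>" for x y
    using that assms(3) by blast
  have "x \<otimes> y \<in> \<Union>\<C> \<and> x \<oplus> y \<in> \<Union>\<C>" if xy: "x \<in> \<Union>\<C>" "y \<in> \<Union>\<C>" for x y
  proof -
    obtain I where I: "I \<in> \<C>" "x \<in> I" "y \<in> I"
      using common[OF xy] by blast
    then have "x \<otimes> y \<in> I" "x \<oplus> y \<in> I"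
      using assms(2)[OF I(1)] by (simp_all add: sb_ideal_iff)
    with I(1) show ?thesis by blast
  qed
  moreover have "\<Union>\<C> \<subseteq> carrier A" "\<zero> \<in> \<Union>\<C>"
    using assms(1,2) sb_ideal_subset sb_ideal_zero by blast+
  moreover have "inv x \<in> \<Union>\<C> \<and> \<ominus> x \<in> \<Union>\<C>
      \<and> (\<forall>a\<in>carrier A. a \<otimes> x \<otimes> inv a \<in> \<Union>\<C> \<and> a \<oplus> x \<oplus> \<ominus> a \<in> \<Union>\<C> \<and> sb_lambda A a x \<in> \<Union>\<C>)"
    if "x \<in> \<Union>\<C>" for x
  proof -
    obtain I where I: "I \<in> \<C>" "x \<in> I" using \<open>x \<in> \<Union>\<C>\<close> by blast
    then show ?thesis
      using assms(2)[OF I(1), unfolded sb_ideal_iff] by (simp only: Union_iff) blast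
  qed
  ultimately show ?thesis
    unfolding sb_ideal_iff by blast
qed

text \<open>A generated subgroup is trivial iff all its generators are. Primeness and semiprimeness
  can thus be tested on single star products.\<close>

lemma sb_star_set_eq_zero_iff:
  "sb_star_set A X Y = {\<zero>} \<longleftrightarrow> (\<forall>x\<in>X. \<forall>y\<in>Y. sb_star A x y = \<zero>)"
proof
  assume "sb_star_set A X Y = {\<zero>}"
  then show "\<forall>x\<in>X. \<forall>y\<in>Y. sb_star A x y = \<zero>"
    unfolding sb_star_set_def by (blast intro: generate.incl)
next
  assume "\<forall>x\<in>X. \<forall>y\<in>Y. sb_star A x y = \<zero>"
  then have "{sb_star A x y | x y. x \<in> X \<and> y \<in> Y} \<subseteq> {\<zero>}" by auto
  then have "sb_star_set A X Y \<subseteq> generate (add_monoid A) {\<zero>}"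
    unfolding sb_star_set_def by (rule add.mono_generate)
  also have "\<dots> = {\<zero>}" using add.generate_one by simp
  finally show "sb_star_set A X Y = {\<zero>}"
    using generate.one[of "add_monoid A"] by (auto simp: sb_star_set_def)
qed

text \<open>On left cosets, \<open>a \<otimes> x = a \<oplus> sb_lambda A a x\<close>, and
  \<open>sb_lambda A a\<close> permutes \<open>I\<close> with inverse
  \<open>sb_lambda A (inv a)\<close>; normality in both groups passes to right cosets. Hence one set
  of cosets carries both quotient groups.\<close>

lemma circ_r_coset_eq_add_r_coset:
  assumes I: "sb_ideal A I" and a: "a \<in> carrier A"
  shows "I #> a = I +> a"
proof -
  have "I #> a = a <# I"
    using I a by (auto simp: sb_ideal_def normal.coset_eq)
  also have "\<dots> = a <+ I"
  proof
    show "a <# I \<subseteq> a <+ I"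
    proof
      fix u assume "u \<in> a <# I"
      then obtain x where x: "x \<in> I" "u = a \<otimes> x" by (auto simp: l_coset_def)
      then have "sb_lambda A a x \<in> I" "u = a \<oplus> sb_lambda A a x"
        using I a sb_ideal_subset[OF I] by (auto simp: sb_ideal_iff circ_eq_add_lambda)
      then show "u \<in> a <+ I" by (auto simp: a_l_coset_def l_coset_def)
    qed
    show "a <+ I \<subseteq> a <# I"
    proof
      fix u assume "u \<in> a <+ I"
      then obtain x where x: "x \<in> I" "u = a \<oplus> x" by (auto simp: a_l_coset_def l_coset_def)
      then have "sb_lambda A (inv a) x \<in> I" "u = a \<otimes> sb_lambda A (inv a) x"
        using I a sb_ideal_subset[OF I] by (auto simp: sb_ideal_iff add_eq_circ_lambda)
      then show "u \<in> a <# I" by (auto simp: l_coset_def)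
    qed
  qed
  also have "\<dots> = I +> a" using I a by (simp add: sb_ideal_def)
  finally show ?thesis .
qed

end

section \<open>Homomorphisms and preimages of ideals\<close>

lemma skew_brace_hom_inv:
  assumes "skew_brace A" "skew_brace B" "h \<in> skew_brace_hom A B" "x \<in> carrier A"
  shows "h (inv\<^bsub>A\<^esub> x) = inv\<^bsub>B\<^esub> (h x)" "h (\<ominus>\<^bsub>A\<^esub> x) = \<ominus>\<^bsub>B\<^esub> (h x)"
proof -
  have "group_hom A B h" "group_hom (add_monoid A) (add_monoid B) h"
    using assms by (auto simp: skew_brace_hom_def skew_brace_def group_hom_def group_hom_axioms_def)
  then show "h (inv\<^bsub>A\<^esub> x) = inv\<^bsub>B\<^esub> (h x)" "h (\<ominus>\<^bsub>A\<^esub> x) = \<ominus>\<^bsub>B\<^esub> (h x)"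
    using group_hom.hom_inv[of A B h x] group_hom.hom_inv[of "add_monoid A" "add_monoid B" h x] assms(4)
    by (simp_all add: a_inv_def)
qed

lemma skew_brace_homD:
  assumes "h \<in> skew_brace_hom A B" "x \<in> carrier A"
  shows "h x \<in> carrier B"
    and "y \<in> carrier A \<Longrightarrow> h (x \<otimes>\<^bsub>A\<^esub> y) = h x \<otimes>\<^bsub>B\<^esub> h y"
    and "y \<in> carrier A \<Longrightarrow> h (x \<oplus>\<^bsub>A\<^esub> y) = h x \<oplus>\<^bsub>B\<^esub> h y"
  using assms by (auto simp: skew_brace_hom_def hom_def)

lemma skew_brace_hom_zero:
  assumes "skew_brace A" "skew_brace B" "h \<in> skew_brace_hom A B"
  shows "h \<zero>\<^bsub>A\<^esub> = \<zero>\<^bsub>B\<^esub>"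
  using assms hom_one[of h "add_monoid A" "add_monoid B"]
  by (auto simp: skew_brace_hom_def skew_brace_def)

lemma skew_brace_hom_lambda:
  assumes "skew_brace A" "skew_brace B" "h \<in> skew_brace_hom A B" "x \<in> carrier A" "y \<in> carrier A"
  shows "h (sb_lambda A x y) = sb_lambda B (h x) (h y)"
proof -
  interpret A: skew_brace A by fact
  show ?thesis
    using assms(4,5) by (simp add: sb_lambda_def skew_brace_homD[OF assms(3)]
      skew_brace_hom_inv[OF assms(1-3)])
qed

lemma skew_brace_hom_star:
  assumes "skew_brace A" "skew_brace B" "h \<in> skew_brace_hom A B" "x \<in> carrier A" "y \<in> carrier A"
  shows "h (sb_star A x y) = sb_star B (h x) (h y)"
proof -
  interpret A: skew_brace A by fact
  show ?thesis
    using assms(4,5) by (simp add: sb_star_def a_minus_def skew_brace_homD[OF assms(3)]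
      skew_brace_hom_inv[OF assms(1-3)] skew_brace_hom_lambda[OF assms(1-3)])
qed

lemma sb_ideal_preimage:
  assumes "skew_brace A" "skew_brace B" "h \<in> skew_brace_hom A B" "sb_ideal B K"
  shows "sb_ideal A {x \<in> carrier A. h x \<in> K}"
proof -
  interpret A: skew_brace A by fact
  interpret B: skew_brace B by fact
  show ?thesis
    using assms(4) unfolding A.sb_ideal_iff B.sb_ideal_iff
    by (auto simp: skew_brace_homD[OF assms(3)] skew_brace_hom_inv[OF assms(1-3)]
      skew_brace_hom_lambda[OF assms(1-3)] skew_brace_hom_zero[OF assms(1-3)])
qed

section \<open>The quotient by an ideal and a criterion for its primeness\<close>

definition sb_quotient :: "('a, 'm) ring_scheme \<Rightarrow> 'a set \<Rightarrow> 'a set ring"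
  where "sb_quotient A I =
    \<lparr>carrier = rcosets\<^bsub>A\<^esub> I, mult = set_mult A, one = I, zero = I, add = set_add A\<rparr>"

context skew_brace
begin

context
  fixes I
  assumes I: "sb_ideal A I"
begin

text \<open>The carrier of \<open>sb_quotient\<close> consists of circle cosets; their agreement
  with additive cosets makes this an equality of records, so factor group results apply.\<close>

lemma add_monoid_sb_quotient: "add_monoid (sb_quotient A I) = add_monoid A Mod I"
proof -
  have "rcosets I = rcosets\<^bsub>add_monoid A\<^esub> I"
    using circ_r_coset_eq_add_r_coset[OF I]
    by (simp add: RCOSETS_def a_r_coset_def)
  then show ?thesis
    by (simp add: sb_quotient_def FactGroup_def set_add_def)
qed

lemma sb_quotient_add_group: "group (add_monoid (sb_quotient A I))"
  unfolding add_monoid_sb_quotient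
  by (rule normal.factorgroup_is_group) (rule sb_ideal_add_normal[OF I])

lemma sb_quotient_circ_group: "group (sb_quotient A I)"
proof -
  have "group (A Mod I)"
    using I by (auto simp: sb_ideal_def intro: normal.factorgroup_is_group)
  then show ?thesis
    \<comment> \<open>\<open>A Mod I\<close> and \<open>sb_quotient A I\<close> are records of
      different types, so the group property is transferred by reducing it to carrier,
      multiplication and unit, where they agree.\<close>
    unfolding group_def monoid_def group_axioms_def Units_def
      sb_quotient_def FactGroup_def partial_object.simps monoid.simps .
qed

lemma sb_quotient_map_hom: "(+>) I \<in> skew_brace_hom A (sb_quotient A I)"
proof -
  have "(#>\<^bsub>add_monoid A\<^esub>) I \<in> hom (add_monoid A) (add_monoid A Mod I)"
    by (rule normal.r_coset_hom_Mod) (rule sb_ideal_add_normal[OF I])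
  moreover have "(#>) I \<in> hom A (A Mod I)"
    using I by (intro normal.r_coset_hom_Mod) (simp add: sb_ideal_def)
  moreover have "I #>\<^bsub>add_monoid A\<^esub> x \<in> rcosets I" if "x \<in> carrier A" for x
    using circ_r_coset_eq_add_r_coset[OF I that] that
    by (auto simp: RCOSETS_def a_r_coset_def)
  ultimately show ?thesis
    unfolding skew_brace_hom_def add_monoid_sb_quotient
    by (auto simp: a_r_coset_def hom_def FactGroup_def sb_quotient_def
      circ_r_coset_eq_add_r_coset[OF I, unfolded a_r_coset_def])
qed

lemma sb_quotient_carrierE:
  assumes "u \<in> carrier (sb_quotient A I)"
  obtains x where "x \<in> carrier A" "u = I +> x"
  using assms circ_r_coset_eq_add_r_coset[OF I] by (auto simp: sb_quotient_def RCOSETS_def)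

lemma skew_brace_sb_quotient: "skew_brace (sb_quotient A I)"
proof (rule skew_brace.intro[OF sb_quotient_add_group sb_quotient_circ_group])
  let ?Q = "sb_quotient A I"
  note hom = skew_brace_homD[OF sb_quotient_map_hom]
  \<comment> \<open>Negation is treated through the additive group alone, because
    \<open>skew_brace_hom_inv\<close> presupposes that the target is a skew brace.\<close>
  have "group_hom (add_monoid A) (add_monoid ?Q) ((+>) I)"
    using sb_quotient_map_hom sb_quotient_add_group add_group
    by (simp add: group_hom_def group_hom_axioms_def skew_brace_hom_def)
  then have neg: "I +> (\<ominus> x) = \<ominus>\<^bsub>?Q\<^esub> (I +> x)" if "x \<in> carrier A" for x
    using group_hom.hom_inv[of "add_monoid A" "add_monoid ?Q" "(+>) I" x] that
    by (simp add: a_inv_def)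
  fix a b c assume "a \<in> carrier ?Q" "b \<in> carrier ?Q" "c \<in> carrier ?Q"
  then obtain x y z where xyz: "x \<in> carrier A" "y \<in> carrier A" "z \<in> carrier A"
    and abc: "a = I +> x" "b = I +> y" "c = I +> z"
    by (metis sb_quotient_carrierE)
  have "I +> (x \<otimes> (y \<oplus> z)) = I +> (x \<otimes> y \<ominus> x \<oplus> x \<otimes> z)"
    using xyz by (simp add: brace)
  then show "a \<otimes>\<^bsub>?Q\<^esub> (b \<oplus>\<^bsub>?Q\<^esub> c) = a \<otimes>\<^bsub>?Q\<^esub> b \<ominus>\<^bsub>?Q\<^esub> a \<oplus>\<^bsub>?Q\<^esub> a \<otimes>\<^bsub>?Q\<^esub> c"
    using xyz by (simp add: abc hom neg a_minus_def)
qed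

lemma sb_quotient_map_eq_zero_iff:
  assumes "x \<in> carrier A"
  shows "I +> x = \<zero>\<^bsub>sb_quotient A I\<^esub> \<longleftrightarrow> x \<in> I"
proof -
  have "subgroup I (add_monoid A)"
    using sb_ideal_add_normal[OF I] by (rule normal_imp_subgroup)
  then show ?thesis
    using assms add.coset_join1[of I x] add.coset_join2[of x I] sb_ideal_subset[OF I]
    by (auto simp: sb_quotient_def a_r_coset_def)
qed

text \<open>Non-zero ideals of the quotient pull back to ideals strictly above \<open>I\<close>. A
  star product of elements of these outside \<open>I\<close> maps to a non-zero star product in the
  quotient.\<close>

lemma prime_sb_quotientI:
  assumes prime: "\<And>J K. \<lbrakk>sb_ideal A J; sb_ideal A K; I \<subset> J; I \<subset> K\<rbrakk>
    \<Longrightarrow> \<exists>x\<in>J. \<exists>y\<in>K. sb_star A x y \<notin> I"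
  shows "prime_skew_brace (sb_quotient A I)"
proof -
  let ?Q = "sb_quotient A I"
  interpret Q: skew_brace ?Q by (rule skew_brace_sb_quotient)
  note hom = skew_brace_axioms Q.skew_brace_axioms sb_quotient_map_hom
  let ?pre = "\<lambda>K. {x \<in> carrier A. I +> x \<in> K}"
  have pre: "I \<subset> ?pre K" if K: "sb_ideal ?Q K" "K \<noteq> {\<zero>\<^bsub>?Q\<^esub>}" for K
  proof
    show "I \<subseteq> ?pre K"
    proof
      fix x assume "x \<in> I"
      then have "x \<in> carrier A" "I +> x = \<zero>\<^bsub>?Q\<^esub>"
        using sb_ideal_subset[OF I] sb_quotient_map_eq_zero_iff[of x] by auto
      then show "x \<in> ?pre K" using Q.sb_ideal_zero[OF K(1)] by simp
    qed
    obtain u where u: "u \<in> K" "u \<noteq> \<zero>\<^bsub>?Q\<^esub>"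
      using K(2) Q.sb_ideal_zero[OF K(1)] by blast
    then obtain x where x: "x \<in> carrier A" "u = I +> x"
      using Q.sb_ideal_subset[OF K(1)] sb_quotient_carrierE[of u] by blast
    with u show "I \<noteq> ?pre K"
      using sb_quotient_map_eq_zero_iff[OF x(1)] by auto
  qed
  have "sb_star_set ?Q J K \<noteq> {\<zero>\<^bsub>?Q\<^esub>}"
    if JK: "sb_ideal ?Q J" "J \<noteq> {\<zero>\<^bsub>?Q\<^esub>}" "sb_ideal ?Q K" "K \<noteq> {\<zero>\<^bsub>?Q\<^esub>}" for J K
  proof -
    obtain x y where xy: "x \<in> ?pre J" "y \<in> ?pre K" "sb_star A x y \<notin> I"
      using prime[OF sb_ideal_preimage[OF hom JK(1)] sb_ideal_preimage[OF hom JK(3)]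
          pre[OF JK(1,2)] pre[OF JK(3,4)]] by blast
    have "sb_star A x y \<in> carrier A"
      using xy by (simp add: sb_star_def a_minus_def)
    then have "sb_star ?Q (I +> x) (I +> y) \<noteq> \<zero>\<^bsub>?Q\<^esub>"
      using xy skew_brace_hom_star[OF hom, of x y]
        sb_quotient_map_eq_zero_iff[of "sb_star A x y"] by simp
    then show ?thesis
      using xy by (auto simp: Q.sb_star_set_eq_zero_iff)
  qed
  then show ?thesis
    unfolding prime_skew_brace_def using Q.skew_brace_axioms by blast
qed

end

section \<open>Generated ideals and ideals maximal among those avoiding a set\<close>

definition sb_ideal_gen :: "'a \<Rightarrow> 'a set"
  where "sb_ideal_gen a = \<Inter>{I. sb_ideal A I \<and> a \<in> I}"

lemma sb_ideal_gen_ideal: "a \<in> carrier A \<Longrightarrow> sb_ideal A (sb_ideal_gen a)"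
  unfolding sb_ideal_gen_def by (rule sb_ideal_Inter) (use sb_ideal_carrier in auto)

lemma sb_ideal_gen_self: "a \<in> sb_ideal_gen a"
  and sb_ideal_gen_least: "\<lbrakk>sb_ideal A I; a \<in> I\<rbrakk> \<Longrightarrow> sb_ideal_gen a \<subseteq> I"
  by (auto simp: sb_ideal_gen_def)

lemma exists_ideal_maximal_disjoint:
  assumes "\<zero> \<notin> S"
  obtains P where "sb_ideal A P" "P \<inter> S = {}"
    "\<And>J. \<lbrakk>sb_ideal A J; P \<subset> J\<rbrakk> \<Longrightarrow> J \<inter> S \<noteq> {}"
proof -
  let ?F = "{J. sb_ideal A J \<and> J \<inter> S = {}}"
  have "\<exists>P\<in>?F. \<forall>J\<in>?F. P \<subseteq> J \<longrightarrow> J = P"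
  \<comment> \<open>The family contains the zero ideal because \<open>\<zero> \<notin> S\<close>,
    and the union of a chain of ideals avoiding \<open>S\<close> again avoids
    \<open>S\<close>.\<close>
  proof (rule subset_Zorn_nonempty)
    show "?F \<noteq> {}" using sb_ideal_zero_set assms by blast
    show "\<Union>\<C> \<in> ?F" if "\<C> \<noteq> {}" "subset.chain ?F \<C>" for \<C>
    proof -
      have "sb_ideal A (\<Union>\<C>)"
        using that by (intro sb_ideal_Union_chain) (auto simp: subset_chain_def)
      then show ?thesis using that by (auto simp: subset_chain_def)
    qed
  qed
  then obtain P where P: "P \<in> ?F" and max: "\<forall>J\<in>?F. P \<subseteq> J \<longrightarrow> J = P"
    by (elim bexE)
  show thesis
  proof (rule that)
    show "sb_ideal A P" "P \<inter> S = {}" using P by simp_all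
    show "J \<inter> S \<noteq> {}" if "sb_ideal A J" "P \<subset> J" for J
      using bspec[OF max, of J] that by auto
  qed
qed

section \<open>Separating a non-zero element from zero by a prime quotient\<close>

lemma semiprime_exists_prime_quotient:
  assumes semiprime: "semiprime_skew_brace A" and a: "a \<in> carrier A" "a \<noteq> \<zero>"
  obtains P where "sb_ideal A P" "a \<notin> P" "prime_skew_brace (sb_quotient A P)"
proof -
  let ?R = "\<lambda>b c. \<exists>x\<in>sb_ideal_gen b. \<exists>y\<in>sb_ideal_gen b. c = sb_star A x y"
  have step: "\<exists>c. (c \<in> carrier A \<and> c \<noteq> \<zero>) \<and> ?R b c"
    if b: "b \<in> carrier A" "b \<noteq> \<zero>" for b
  proof -
    have gen: "sb_ideal A (sb_ideal_gen b)" using b by (simp add: sb_ideal_gen_ideal)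
    have "sb_ideal_gen b \<noteq> {\<zero>}" using b sb_ideal_gen_self[of b] by auto
    with semiprime gen have "sb_star_set A (sb_ideal_gen b) (sb_ideal_gen b) \<noteq> {\<zero>}"
      by (simp add: semiprime_skew_brace_def)
    then obtain x y where "x \<in> sb_ideal_gen b" "y \<in> sb_ideal_gen b" "sb_star A x y \<noteq> \<zero>"
      by (auto simp: sb_star_set_eq_zero_iff)
    with sb_ideal_star[OF gen] sb_ideal_subset[OF gen] show ?thesis by blast
  qed
  \<comment> \<open>The clause guarded by \<open>n = 0\<close> pins the start of the sequence to
    \<open>a\<close>, which dependent choice alone would leave open.\<close>
  have "\<exists>s. \<forall>n. ((s n \<in> carrier A \<and> s n \<noteq> \<zero>) \<and> (n = 0 \<longrightarrow> s n = a)) \<and> ?R (s n) (s (Suc n))"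
  proof (rule dependent_nat_choice)
    show "\<exists>b. (b \<in> carrier A \<and> b \<noteq> \<zero>) \<and> (0 = (0 :: nat) \<longrightarrow> b = a)"
      using a by blast
    show "\<exists>c. ((c \<in> carrier A \<and> c \<noteq> \<zero>) \<and> (Suc n = 0 \<longrightarrow> c = a)) \<and> ?R b c"
      if "(b \<in> carrier A \<and> b \<noteq> \<zero>) \<and> (n = 0 \<longrightarrow> b = a)" for b n
      using step[of b] that by simp
  qed
  then obtain s where seq: "\<forall>n. ((s n \<in> carrier A \<and> s n \<noteq> \<zero>) \<and> (n = 0 \<longrightarrow> s n = a))
      \<and> ?R (s n) (s (Suc n))"
    by (elim exE)
  have s: "s n \<in> carrier A" "s n \<noteq> \<zero>" "s 0 = a" "?R (s n) (s (Suc n))" for n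
    using spec[OF seq, of n] spec[OF seq, of 0] by simp_all
  have gen: "sb_ideal A (sb_ideal_gen (s n))" for n
    using s by (simp add: sb_ideal_gen_ideal)
  have "sb_ideal_gen (s (Suc n)) \<subseteq> sb_ideal_gen (s n)" for n
    using s(4)[of n] sb_ideal_star[OF gen] by (intro sb_ideal_gen_least[OF gen]) auto
  then have anti: "sb_ideal_gen (s n) \<subseteq> sb_ideal_gen (s m)" if "m \<le> n" for m n
    using that by (rule lift_Suc_antimono_le)
  have "\<zero> \<notin> range s" using s(2) by (metis imageE)
  then obtain P where P: "sb_ideal A P" "P \<inter> range s = {}"
    and max: "\<And>J. \<lbrakk>sb_ideal A J; P \<subset> J\<rbrakk> \<Longrightarrow> J \<inter> range s \<noteq> {}"
    by (rule exists_ideal_maximal_disjoint) blast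
  have "prime_skew_brace (sb_quotient A P)"
  proof (rule prime_sb_quotientI[OF P(1)])
    fix J K assume JK: "sb_ideal A J" "sb_ideal A K" "P \<subset> J" "P \<subset> K"
    obtain m n where mn: "s m \<in> J" "s n \<in> K"
      using max[OF JK(1,3)] max[OF JK(2,4)] by auto
    \<comment> \<open>The ideals generated by the terms decrease, so from the larger index on they
      lie in both \<open>J\<close> and \<open>K\<close>.\<close>
    let ?k = "max m n"
    have sub: "sb_ideal_gen (s ?k) \<subseteq> J" "sb_ideal_gen (s ?k) \<subseteq> K"
      using anti[of m ?k] sb_ideal_gen_least[OF JK(1) mn(1)]
        anti[of n ?k] sb_ideal_gen_least[OF JK(2) mn(2)] by simp_all
    obtain x y where xy: "x \<in> sb_ideal_gen (s ?k)" "y \<in> sb_ideal_gen (s ?k)"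
      "s (Suc ?k) = sb_star A x y"
      using s(4)[of ?k] by (elim bexE)
    have "s (Suc ?k) \<notin> P" using P(2) by auto
    then have "sb_star A x y \<notin> P" by (simp only: xy(3) not_False_eq_True)
    with sub xy(1,2) show "\<exists>x\<in>J. \<exists>y\<in>K. sb_star A x y \<notin> P"
      by (intro bexI[of _ x] bexI[of _ y]) (simp_all add: subsetD)
  qed
  \<comment> \<open>\<open>P\<close> avoids the whole sequence, in particular its first term
    \<open>a\<close>.\<close>
  moreover have "a \<notin> P" using P(2) s(3) by auto
  ultimately show thesis using P(1) by (intro that)
qed

end

theorem theorem4p24:
  fixes A :: "('a, 'm) ring_scheme"
  assumes "semiprime_skew_brace A"
  shows "\<exists>(T :: 'a set set) (Q :: 'a set \<Rightarrow> 'a set ring) h.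
    (\<forall>i\<in>T. prime_skew_brace (Q i)) \<and>
    h \<in> skew_brace_hom A (skew_brace_product T Q) \<and> inj_on h (carrier A)"
proof -
  interpret skew_brace A using assms by (simp add: semiprime_skew_brace_def)
  \<comment> \<open>The ideals with prime quotient index their own quotients.\<close>
  let ?T = "{P. sb_ideal A P \<and> prime_skew_brace (sb_quotient A P)}"
  let ?P = "skew_brace_product ?T (sb_quotient A)"
  \<comment> \<open>The restriction to \<open>?T\<close> is forced by the extensional function space
    that carries the product.\<close>
  let ?h = "\<lambda>x. \<lambda>P\<in>?T. P +>\<^bsub>A\<^esub> x"
  have "skew_brace ?P"
    by (rule skew_brace_product) (simp add: prime_skew_brace_def)
  then interpret P: skew_brace ?P .
  have hom: "?h \<in> skew_brace_hom A ?P"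
    by (auto simp: skew_brace_hom_def hom_def skew_brace_product_def fun_eq_iff
      skew_brace_homD[OF sb_quotient_map_hom])
  have "group_hom (add_monoid A) (add_monoid ?P) ?h"
    using hom add_group P.add_group
    by (simp add: group_hom_def group_hom_axioms_def skew_brace_hom_def)
  then interpret h: group_hom "add_monoid A" "add_monoid ?P" ?h .
  \<comment> \<open>An element of the kernel lies in every \<open>P\<close> of \<open>?T\<close>,
    whereas a non-zero element is missed by some such \<open>P\<close>.\<close>
  have ker: "x = \<zero>\<^bsub>A\<^esub>" if x: "x \<in> carrier A" "?h x = \<zero>\<^bsub>?P\<^esub>" for x
  proof (rule ccontr)
    assume "x \<noteq> \<zero>\<^bsub>A\<^esub>"
    then obtain P where P: "sb_ideal A P" "x \<notin> P" "prime_skew_brace (sb_quotient A P)"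
      by (rule semiprime_exists_prime_quotient[OF assms x(1)])
    then have "P +>\<^bsub>A\<^esub> x = \<zero>\<^bsub>sb_quotient A P\<^esub>"
      using fun_cong[OF x(2), of P] by (simp add: skew_brace_product_def)
    with P x(1) show False by (simp add: sb_quotient_map_eq_zero_iff)
  qed
  have "inj_on ?h (carrier (add_monoid A))"
    unfolding h.inj_on_one_iff using ker by simp
  then have "inj_on ?h (carrier A)" by simp
  with hom show ?thesis by (intro exI[of _ ?T] exI[of _ "sb_quotient A"] exI[of _ ?h]) auto
qed

end
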